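(* $\mathrm{ord}(\mathcal{K}_2) = \omega_1$.
   Context: For a partial combinatory algebra (pca) $\mathcal{A}$ (a set with partial application $ab$, associating to the left, with elements $K,S$ such that $Kab$ is defined and equals $a$, and $Sab$ is defined with $Sabc\simeq ac(bc)$), closed terms are built from elements by application, and $s\simeq t$ means both undefined or both defined and equal. Relations $\sim_\alpha$ on closed terms: $s\sim_0 t$ iff $s\simeq t$; $s \sim_{\alpha+1} t$ iff $sx \sim_\alpha tx$ for all $x\in\mathcal{A}$; for limit $\alpha$, $s\sim_\alpha t$ iff $s\sim_\beta t$ for some $\beta<\alpha$. $\mathrm{ord}(\mathcal{A})$ is the least ordinal $\alpha$ such that $\sim_\alpha$ equals $\sim_{\alpha+1}$. Kleene's second model $\mathcal{K}_2$ is the pca on Baire space $\omega^\omega$ where $f\cdot g$ is the result of applying the partial continuous functional coded by $f$ (in Kleene's standard coding) to $g$: $f\cdot g$ is defined iff for every $n$ there is $k$ with $f(\langle n, g(0),\dots,g(k-1)\rangle)>0$, in which case $(f\cdot g)(n)=f(\langle n,g(0),\dots,g(k-1)\rangle)-1$ for the least such $k$. $\omega_1$ is the first uncountable ordinal. *)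

theory Defs
  imports "HOL-Library.Nat_Bijection" "HOL-Library.Countable_Set"
begin

section \<open>Ordinals\<close>

text \<open>
  An element of \<^verbatim>\<open>'a ordinal\<close> is the order type of a well-order on a subset of \<^verbatim>\<open>'a\<close>.
  For infinite \<^verbatim>\<open>'a\<close> these are the ordinals below the cardinal successor of the cardinality of
  \<^verbatim>\<open>'a\<close>; there is then no largest one.
\<close>

quotient_type 'a ordinal = "'a rel" / partial: "\<lambda>r s. (r, s) \<in> ordIso"
proof (rule part_equivpI)
  show "\<exists>r::'a rel. (r, r) \<in> ordIso"
    using card_of_Well_order ordIso_reflexive by blast
  show "symp (\<lambda>r s::'a rel. (r, s) \<in> ordIso)"
    by (auto intro: sympI ordIso_symmetric)
  show "transp (\<lambda>r s::'a rel. (r, s) \<in> ordIso)"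
    by (auto intro: transpI ordIso_transitive)
qed

lemma rep_ordinal_ordIso: "(rep_ordinal \<alpha>, rep_ordinal \<alpha>) \<in> ordIso"
  by (rule Quotient3_rep_reflp[OF Quotient3_ordinal])

lemma Well_order_rep_ordinal: "Well_order (rep_ordinal \<alpha>)"
  using rep_ordinal_ordIso unfolding ordIso_def by blast

lemma rep_ordinal_eqI: "(rep_ordinal \<alpha>, rep_ordinal \<beta>) \<in> ordIso \<Longrightarrow> \<alpha> = \<beta>"
  using Quotient3_rel_rep[OF Quotient3_ordinal] by blast

lemma rep_abs_ordinal: "Well_order r \<Longrightarrow> (rep_ordinal (abs_ordinal r), r) \<in> ordIso"
  by (rule rep_abs_rsp_left[OF Quotient3_ordinal], rule ordIso_reflexive)

instantiation ordinal :: (type) wellorder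
begin

definition less_eq_ordinal :: "'a ordinal \<Rightarrow> 'a ordinal \<Rightarrow> bool" where
  "\<alpha> \<le> \<beta> \<longleftrightarrow> (rep_ordinal \<alpha>, rep_ordinal \<beta>) \<in> ordLeq"

definition less_ordinal :: "'a ordinal \<Rightarrow> 'a ordinal \<Rightarrow> bool" where
  "\<alpha> < \<beta> \<longleftrightarrow> (rep_ordinal \<alpha>, rep_ordinal \<beta>) \<in> ordLess"

instance
proof
  fix \<alpha> \<beta> \<gamma> :: "'a ordinal"
  show "\<alpha> < \<beta> \<longleftrightarrow> \<alpha> \<le> \<beta> \<and> \<not> \<beta> \<le> \<alpha>"
    unfolding less_ordinal_def less_eq_ordinal_def
    using Well_order_rep_ordinal not_ordLeq_iff_ordLess ordLess_imp_ordLeq by blast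
  show "\<alpha> \<le> \<alpha>"
    unfolding less_eq_ordinal_def by (simp add: Well_order_rep_ordinal ordLeq_reflexive)
  show "\<alpha> \<le> \<gamma>" if "\<alpha> \<le> \<beta>" "\<beta> \<le> \<gamma>"
    using that unfolding less_eq_ordinal_def by (rule ordLeq_transitive)
  show "\<alpha> = \<beta>" if "\<alpha> \<le> \<beta>" "\<beta> \<le> \<alpha>"
    using that unfolding less_eq_ordinal_def by (simp add: ordIso_iff_ordLeq rep_ordinal_eqI)
  show "\<alpha> \<le> \<beta> \<or> \<beta> \<le> \<alpha>"
    unfolding less_eq_ordinal_def using Well_order_rep_ordinal ordLeq_total by blast
next
  fix P :: "'a ordinal \<Rightarrow> bool" and \<alpha>
  assume step: "\<And>\<alpha>. (\<And>\<beta>. \<beta> < \<alpha> \<Longrightarrow> P \<beta>) \<Longrightarrow> P \<alpha>"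
  have "wf (inv_image ordLess (rep_ordinal :: 'a ordinal \<Rightarrow> _))"
    by (rule wf_inv_image[OF wf_ordLess])
  then show "P \<alpha>"
    by (induction \<alpha> rule: wf_induct_rule) (rule step, simp add: less_ordinal_def)
qed

end

instantiation ordinal :: (type) zero
begin
definition zero_ordinal :: "'a ordinal" where
  "(0 :: 'a ordinal) = (LEAST \<alpha>. True)"
instance ..
end

definition succ_ord :: "'a ordinal \<Rightarrow> 'a ordinal" where
  "succ_ord \<alpha> = (LEAST \<beta>. \<alpha> < \<beta>)"

lemma ex_greater_ordinal:
  assumes "infinite (UNIV :: 'a set)"
  shows "\<exists>\<beta> :: 'a ordinal. \<alpha> < \<beta>"
proof -
  define x :: 'a where "x = undefined"
  obtain f :: "'a \<Rightarrow> 'a" where "bij_betw f UNIV (UNIV - {x})"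
    using infinite_imp_bij_betw[OF assms] by blast
  then have f: "inj f" "x \<notin> range f"
    by (auto simp: bij_betw_def)
  define r where "r = dir_image (rep_ordinal \<alpha>) f"
  define s where "s = r \<union> insert x (Field r) \<times> {x}"
  have iso: "(rep_ordinal \<alpha>, r) \<in> ordIso"
    unfolding r_def
    by (rule dir_image_ordIso[OF Well_order_rep_ordinal inj_on_subset[OF f(1) subset_UNIV]])
  then have r: "Well_order r"
    by (simp add: ordIso_def)
  have x: "x \<notin> Field r"
    using f(2) by (auto simp: r_def dir_image_Field)
  have rx: "(x, y) \<notin> r" "(y, x) \<notin> r" for y
    using x by (auto simp: Field_def)
  have field: "Field s = insert x (Field r)"
    by (auto simp: s_def Field_def)
  have lin: "Refl r" "trans r" "antisym r" "Total r" "wf (r - Id)"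
    using r by (auto simp: order_on_defs)
  have "Refl s"
    using lin(1) unfolding refl_on_def field by (auto simp: s_def)
  moreover have "trans s"
    using transD[OF lin(2)] rx by (intro transI) (auto simp: s_def Field_def)
  moreover have "antisym s"
    using antisymD[OF lin(3)] rx x by (intro antisymI) (auto simp: s_def)
  moreover have "Total s"
    using lin(4) unfolding total_on_def field by (auto simp: s_def)
  moreover have "wf (s - Id)"
  proof -
    have "wf (Field r \<times> {x})"
    proof (rule wfUNIVI)
      fix P y
      assume step: "\<forall>y. (\<forall>z. (z, y) \<in> Field r \<times> {x} \<longrightarrow> P z) \<longrightarrow> P y"
      have "P z" if "z \<noteq> x" for z
        using step that by simp
      then show "P y"
        using step x by (metis SigmaE2)
    qed
    then have "wf ((r - Id) \<union> Field r \<times> {x})"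
      using rx by (intro wf_Un lin(5)) auto
    moreover have "s - Id = (r - Id) \<union> Field r \<times> {x}"
      using x by (auto simp: s_def)
    ultimately show ?thesis by simp
  qed
  moreover have "s \<subseteq> Field s \<times> Field s"
    by (auto simp: Field_def)
  ultimately have s: "Well_order s"
    by (simp add: order_on_defs)
  have "underS s x = Field r"
    using x rx by (auto simp: s_def underS_def)
  moreover have "Restr s (Field r) = r"
    using x by (auto simp: s_def Field_def)
  ultimately have "(r, s) \<in> ordLess"
    using underS_Restr_ordLess[OF s, of x] field by simp
  from ordIso_ordLess_trans[OF iso this] have "\<alpha> < abs_ordinal s"
    unfolding less_ordinal_def
    by (rule ordLess_ordIso_trans) (rule ordIso_symmetric[OF rep_abs_ordinal[OF s]])
  then show ?thesis ..
qed

definition limit_ord :: "'a ordinal \<Rightarrow> bool" where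
  "limit_ord \<alpha> \<longleftrightarrow> \<alpha> \<noteq> 0 \<and> (\<forall>\<beta>. \<alpha> \<noteq> succ_ord \<beta>)"

text \<open>The first uncountable ordinal; it exists in \<^verbatim>\<open>'a ordinal\<close> as soon as \<^verbatim>\<open>'a\<close> is uncountable.\<close>

definition omega1 :: "'a ordinal" where
  "omega1 = (LEAST \<alpha>. uncountable {..<\<alpha>})"

lemma ex_uncountable_lessThan_ordinal:
  assumes "uncountable (UNIV :: 'a set)"
  shows "\<exists>\<alpha> :: 'a ordinal. uncountable {..<\<alpha>}"
proof -
  define r where "r = card_of (UNIV :: 'a set)"
  have r: "Well_order r" "Field r = UNIV"
    unfolding r_def by (rule card_of_Well_order, rule Field_card_of)
  have wo: "wo_rel r" unfolding wo_rel_def by (rule r(1))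
  define t where "t a = abs_ordinal (Restr r (underS r a))" for a
  have rep: "(rep_ordinal (t a), Restr r (underS r a)) \<in> ordIso" for a
    unfolding t_def by (simp add: Well_order_Restr r(1) rep_abs_ordinal)
  have "t a < abs_ordinal r" for a
  proof -
    have "(Restr r (underS r a), r) \<in> ordLess"
      using underS_Restr_ordLess[of r a] r by simp
    from ordIso_ordLess_trans[OF rep this] show ?thesis
      unfolding less_ordinal_def
      by (rule ordLess_ordIso_trans) (rule ordIso_symmetric[OF rep_abs_ordinal[OF r(1)]])
  qed
  moreover have "inj t"
  proof (rule injI)
    fix a b assume eq: "t a = t b"
    have "(Restr r (underS r a), Restr r (underS r b)) \<in> ordIso"
      using ordIso_transitive[OF ordIso_symmetric[OF rep[of a]]] rep[of b] eq by simp
    then have nl: "(Restr r (underS r a), Restr r (underS r b)) \<notin> ordLess"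
      "(Restr r (underS r b), Restr r (underS r a)) \<notin> ordLess"
      using not_ordLess_ordIso ordIso_symmetric by auto
    have "\<not> underS r a < underS r b" "\<not> underS r b < underS r a"
      using nl ofilter_subset_ordLess[OF r(1) wo_rel.underS_ofilter[OF wo] wo_rel.underS_ofilter[OF wo]] by auto
    moreover have "underS r a \<subseteq> underS r b \<or> underS r b \<subseteq> underS r a"
      using wo_rel.ofilter_linord[OF wo wo_rel.underS_ofilter[OF wo] wo_rel.underS_ofilter[OF wo]] by auto
    ultimately have eq': "underS r a = underS r b" by auto
    have "(a, b) \<in> r \<or> (b, a) \<in> r"
      using wo_rel.TOTALS[OF wo] r(2) by simp
    then show "a = b"
      using eq' unfolding underS_def by auto
  qed
  ultimately have "range t \<subseteq> {..<abs_ordinal r}" "uncountable (range t)"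
    using assms countable_image_inj_on[of t UNIV] by auto
  then show ?thesis
    using countable_subset by blast
qed


section \<open>Partial combinatory algebras\<close>

text \<open>A partial application is a function into an option type; \<^term>\<open>None\<close> means undefined.\<close>

datatype 'a cterm = Elem 'a | App "'a cterm" "'a cterm" (infixl "\<cdot>" 70)

primrec eval_cterm :: "('a \<Rightarrow> 'a \<Rightarrow> 'a option) \<Rightarrow> 'a cterm \<Rightarrow> 'a option" where
  "eval_cterm app (Elem a) = Some a"
| "eval_cterm app (s \<cdot> t) =
     (case (eval_cterm app s, eval_cterm app t) of (Some a, Some b) \<Rightarrow> app a b | _ \<Rightarrow> None)"

definition kleene_eq :: "('a \<Rightarrow> 'a \<Rightarrow> 'a option) \<Rightarrow> 'a cterm \<Rightarrow> 'a cterm \<Rightarrow> bool" where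
  "kleene_eq app s t \<longleftrightarrow> eval_cterm app s = eval_cterm app t"

definition pca :: "('a \<Rightarrow> 'a \<Rightarrow> 'a option) \<Rightarrow> bool" where
  "pca app \<longleftrightarrow> (\<exists>K S.
     (\<forall>a b. eval_cterm app (Elem K \<cdot> Elem a \<cdot> Elem b) = Some a) \<and>
     (\<forall>a b. eval_cterm app (Elem S \<cdot> Elem a \<cdot> Elem b) \<noteq> None) \<and>
     (\<forall>a b c. kleene_eq app (Elem S \<cdot> Elem a \<cdot> Elem b \<cdot> Elem c)
                            (Elem a \<cdot> Elem c \<cdot> (Elem b \<cdot> Elem c))))"

inductive sim :: "('a \<Rightarrow> 'a \<Rightarrow> 'a option) \<Rightarrow> 'a ordinal \<Rightarrow> 'a cterm \<Rightarrow> 'a cterm \<Rightarrow> bool"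
  for app where
  zero: "kleene_eq app s t \<Longrightarrow> sim app 0 s t"
| succ: "(\<And>x. sim app \<alpha> (s \<cdot> Elem x) (t \<cdot> Elem x)) \<Longrightarrow> sim app (succ_ord \<alpha>) s t"
| limit: "limit_ord \<alpha> \<Longrightarrow> \<beta> < \<alpha> \<Longrightarrow> sim app \<beta> s t \<Longrightarrow> sim app \<alpha> s t"

text \<open>
  A pca on \<^verbatim>\<open>'a\<close> with more than one element is infinite, so that the increasing sequence of
  relations \<^term>\<open>sim app \<alpha>\<close> on closed terms becomes stationary below the cardinal successor of
  the cardinality of \<^verbatim>\<open>'a\<close>, that is, within \<^verbatim>\<open>'a ordinal\<close>.
\<close>

definition ord_pca :: "('a \<Rightarrow> 'a \<Rightarrow> 'a option) \<Rightarrow> 'a ordinal" where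
  "ord_pca app = (LEAST \<alpha>. sim app \<alpha> = sim app (succ_ord \<alpha>))"


section \<open>Kleene's second model\<close>

text \<open>Sequence numbers are given by the bijective coding \<^const>\<open>list_encode\<close> of finite sequences.\<close>

definition K2_query :: "(nat \<Rightarrow> nat) \<Rightarrow> nat \<Rightarrow> nat \<Rightarrow> nat" where
  "K2_query g n k = list_encode (n # map g [0..<k])"

definition K2_app :: "(nat \<Rightarrow> nat) \<Rightarrow> (nat \<Rightarrow> nat) \<Rightarrow> (nat \<Rightarrow> nat) option" where
  "K2_app f g =
     (if \<forall>n. \<exists>k. f (K2_query g n k) > 0
      then Some (\<lambda>n. f (K2_query g n (LEAST k. f (K2_query g n k) > 0)) - 1)
      else None)"

end

theory Submission
  imports Defs
begin

text \<open>
  If \<^verbatim>\<open>s x\<^sub>1 \<dots> x\<^sub>k\<close> and \<^verbatim>\<open>t x\<^sub>1 \<dots> x\<^sub>k\<close> differ for every prefix of some infinite sequence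
  \<^verbatim>\<open>x\<^sub>1, x\<^sub>2, \<dots>\<close>, then \<^verbatim>\<open>s\<close> and \<^verbatim>\<open>t\<close> are related at no ordinal. In Kleene's second model
  definedness, undefinedness and distinctness of values are all closed conditions relative to a
  witness in Baire space. Hence if \<^verbatim>\<open>s\<close> and \<^verbatim>\<open>t\<close> are not related at any countable ordinal, such a
  sequence is found by successively fixing finite approximations (of which there are only countably
  many) of longer and longer witnessed finite sequences, keeping the ranks of the last pairs
  unbounded in \<^verbatim>\<open>\<omega>\<^sub>1\<close>; this is the argument of the Kunen--Martin theorem. Conversely, countably many
  pairs \<^verbatim>\<open>(f\<^sub>n, g\<^sub>n)\<close> can be joined to a pair \<^verbatim>\<open>(F, G)\<close> with \<^verbatim>\<open>F \<noteq> G\<close>, \<^verbatim>\<open>F x = f\<^bsub>x(0)\<^esub>\<close> and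
  \<^verbatim>\<open>G x = g\<^bsub>x(0)\<^esub>\<close>, so that pairs first related beyond any given countable ordinal exist.
\<close>

section \<open>Successors and the first uncountable ordinal\<close>

context
  assumes inf: "infinite (UNIV :: 'a set)"
begin

lemma less_succ_ord: "(\<alpha> :: 'a ordinal) < succ_ord \<alpha>"
  unfolding succ_ord_def using ex_greater_ordinal[OF inf] by (rule LeastI_ex)

lemma succ_ord_le_iff: "succ_ord (\<alpha> :: 'a ordinal) \<le> \<beta> \<longleftrightarrow> \<alpha> < \<beta>"
proof
  show "succ_ord \<alpha> \<le> \<beta> \<Longrightarrow> \<alpha> < \<beta>"
    using less_succ_ord by (rule less_le_trans)
  show "\<alpha> < \<beta> \<Longrightarrow> succ_ord \<alpha> \<le> \<beta>"
    unfolding succ_ord_def by (rule Least_le)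
qed

lemma less_succ_ord_iff: "(\<alpha> :: 'a ordinal) < succ_ord \<beta> \<longleftrightarrow> \<alpha> \<le> \<beta>"
  using succ_ord_le_iff[of \<beta> \<alpha>] by (metis not_less)

end

lemma zero_ordinal_le: "(0 :: 'a ordinal) \<le> \<alpha>"
  unfolding zero_ordinal_def by (simp add: Least_le)

lemma countable_lessThan_ordinal: "\<alpha> < omega1 \<Longrightarrow> countable {..<\<alpha> :: 'a ordinal}"
  unfolding omega1_def using not_less_Least by blast

text \<open>If \<open>B\<close> were cofinal, the initial segment below \<open>omega1\<close> would
  be a countable union of countable sets.\<close>

lemma omega1_regular:
  assumes unc: "uncountable (UNIV :: 'a set)"
    and B: "countable B" "B \<subseteq> {..<omega1 :: 'a ordinal}"
  shows "\<exists>\<gamma> < omega1. \<forall>\<beta>\<in>B. \<beta> < \<gamma>"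
proof (rule ccontr)
  assume "\<not> ?thesis"
  then have "{..<omega1} \<subseteq> (\<Union>\<beta>\<in>B. insert \<beta> {..<\<beta>})"
    by (fastforce simp: not_less le_less)
  moreover have "countable (\<Union>\<beta>\<in>B. insert \<beta> {..<\<beta>})"
    using B by (intro countable_UN countable_insert countable_lessThan_ordinal) auto
  moreover have "uncountable {..<omega1 :: 'a ordinal}"
    unfolding omega1_def using ex_uncountable_lessThan_ordinal[OF unc] by (rule LeastI_ex)
  ultimately show False
    using countable_subset by blast
qed

text \<open>Otherwise each colour \<open>u\<close> stops occurring from some \<open>b u\<close> on,
  and an ordinal below \<open>omega1\<close> but above these countably many bounds has no possible
  colour.\<close>

lemma omega1_pigeonhole:
  fixes c :: "'a ordinal \<Rightarrow> 'b :: countable"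
  assumes unc: "uncountable (UNIV :: 'a set)"
  shows "\<exists>u. \<forall>\<beta> < omega1. \<exists>\<beta>' < omega1. \<beta> \<le> \<beta>' \<and> c \<beta>' = u"
proof (rule ccontr)
  assume "\<not> ?thesis"
  then obtain b where b: "\<And>u. b u < omega1" "\<And>u \<beta>'. \<beta>' < omega1 \<Longrightarrow> b u \<le> \<beta>' \<Longrightarrow> c \<beta>' \<noteq> u"
    by metis
  obtain \<gamma> where "\<gamma> < omega1" "\<forall>\<beta> \<in> range b. \<beta> < \<gamma>"
    using omega1_regular[OF unc, of "range b"] b(1) by auto
  then show False
    using b(2)[of \<gamma> "c \<gamma>"] by (simp add: less_imp_le)
qed


section \<open>The relations on closed terms\<close>

lemma eval_cterm_App_Elem:
  "eval_cterm app (s \<cdot> Elem x) = Option.bind (eval_cterm app s) (\<lambda>f. app f x)"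
  by (simp split: option.split)

context
  fixes app :: "'a \<Rightarrow> 'a \<Rightarrow> 'a option"
  assumes inf: "infinite (UNIV :: 'a set)"
begin

lemma sim_unfold:
  "sim app \<alpha> s t \<Longrightarrow> kleene_eq app s t \<or> (\<exists>\<beta><\<alpha>. \<forall>x. sim app \<beta> (s \<cdot> Elem x) (t \<cdot> Elem x))"
proof (induction rule: sim.induct)
  case (succ \<alpha> s t)
  then show ?case
    using less_succ_ord[OF inf] by blast
next
  case (limit \<alpha> \<beta> s t)
  then show ?case
    by (meson less_trans)
qed simp

lemma kleene_eq_imp_sim: "kleene_eq app s t \<Longrightarrow> sim app \<alpha> s t"
proof (induction \<alpha> arbitrary: s t rule: less_induct)
  case (less \<alpha>)
  consider "\<alpha> = 0" | \<beta> where "\<alpha> = succ_ord \<beta>" | "limit_ord \<alpha>"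
    unfolding limit_ord_def by blast
  then show ?case
  proof cases
    case 1
    then show ?thesis using less.prems by (simp add: sim.zero)
  next
    case 2
    have "kleene_eq app (s \<cdot> Elem x) (t \<cdot> Elem x)" for x
      using less.prems by (simp add: kleene_eq_def)
    then show ?thesis
      unfolding 2 using less.IH[of \<beta>] less_succ_ord[OF inf] 2 by (blast intro: sim.succ)
  next
    case 3
    then have "0 < \<alpha>"
      using zero_ordinal_le[of \<alpha>] by (auto simp: limit_ord_def le_less)
    then show ?thesis
      using 3 less.prems by (blast intro: sim.limit sim.zero)
  qed
qed

lemma sim_mono: "\<beta> \<le> \<alpha> \<Longrightarrow> sim app \<beta> s t \<Longrightarrow> sim app \<alpha> s t"
proof (induction \<alpha> arbitrary: \<beta> s t rule: less_induct)
  case (less \<alpha>)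
  show ?case
  proof (cases "\<beta> = \<alpha>")
    case False
    then have lt: "\<beta> < \<alpha>" using less.prems(1) by simp
    then consider \<delta> where "\<alpha> = succ_ord \<delta>" | "limit_ord \<alpha>"
      unfolding limit_ord_def using zero_ordinal_le[of \<beta>] by (metis not_le)
    then show ?thesis
    proof cases
      case 1
      have "sim app \<delta> (s \<cdot> Elem x) (t \<cdot> Elem x)"
        if "\<beta>' < \<beta>" "\<forall>x. sim app \<beta>' (s \<cdot> Elem x) (t \<cdot> Elem x)" for \<beta>' x
      proof (rule less.IH)
        show "\<delta> < \<alpha>" unfolding 1 by (rule less_succ_ord[OF inf])
        show "\<beta>' \<le> \<delta>"
          using that(1) lt unfolding 1 less_succ_ord_iff[OF inf] by simp
        show "sim app \<beta>' (s \<cdot> Elem x) (t \<cdot> Elem x)" using that(2) ..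
      qed
      then show ?thesis
        using sim_unfold[OF less.prems(2)] kleene_eq_imp_sim sim.succ unfolding 1 by metis
    next
      case 2
      then show ?thesis using lt less.prems(2) by (rule sim.limit)
    qed
  qed (use less.prems in simp)
qed

text \<open>Treats zero, successor and limit levels uniformly, so later arguments need only
  well-founded induction.\<close>

lemma sim_iff:
  "sim app \<alpha> s t \<longleftrightarrow> kleene_eq app s t \<or> (\<exists>\<beta><\<alpha>. \<forall>x. sim app \<beta> (s \<cdot> Elem x) (t \<cdot> Elem x))"
proof
  assume "kleene_eq app s t \<or> (\<exists>\<beta><\<alpha>. \<forall>x. sim app \<beta> (s \<cdot> Elem x) (t \<cdot> Elem x))"
  then show "sim app \<alpha> s t"
    using kleene_eq_imp_sim sim.succ sim_mono succ_ord_le_iff[OF inf] by blast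
qed (rule sim_unfold)

lemma sim_cong:
  "eval_cterm app s = eval_cterm app s' \<Longrightarrow> eval_cterm app t = eval_cterm app t' \<Longrightarrow>
    sim app \<alpha> s t \<longleftrightarrow> sim app \<alpha> s' t'"
proof (induction \<alpha> arbitrary: s t s' t' rule: less_induct)
  case (less \<alpha>)
  have "sim app \<beta> (s \<cdot> Elem x) (t \<cdot> Elem x) \<longleftrightarrow> sim app \<beta> (s' \<cdot> Elem x) (t' \<cdot> Elem x)"
    if "\<beta> < \<alpha>" for \<beta> x
    using that less.prems by (intro less.IH) simp_all
  then show ?case
    using less.prems by (auto simp: sim_iff[of \<alpha>] kleene_eq_def)
qed

text \<open>By induction all applications are already related at \<alpha>, which relates the terms
  at \<open>succ_ord \<alpha>\<close>, the same relation.\<close>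

lemma sim_stationary:
  assumes "sim app \<alpha> = sim app (succ_ord \<alpha>)"
  shows "sim app \<gamma> s t \<Longrightarrow> sim app \<alpha> s t"
proof (induction \<gamma> arbitrary: s t rule: less_induct)
  case (less \<gamma>)
  from less.prems consider "kleene_eq app s t"
    | \<beta> where "\<beta> < \<gamma>" "\<forall>x. sim app \<beta> (s \<cdot> Elem x) (t \<cdot> Elem x)"
    using sim_iff[of \<gamma> s t] by blast
  then show ?case
  proof cases
    case 1
    then show ?thesis by (rule kleene_eq_imp_sim)
  next
    case 2
    then have "sim app (succ_ord \<alpha>) s t"
      using less.IH by (blast intro: sim.succ)
    then show ?thesis by (simp add: assms)
  qed
qed

text \<open>A relation at \<gamma> for the pair \<open>i\<close> would pass to a smaller ordinal for
  the pair \<open>Suc i\<close>, giving an infinite descent.\<close>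

lemma not_sim_infinite_branch:
  assumes branch: "\<And>i. eval_cterm app (S (Suc i)) = eval_cterm app (S i \<cdot> Elem (x i))"
      "\<And>i. eval_cterm app (T (Suc i)) = eval_cterm app (T i \<cdot> Elem (x i))"
    and ne: "\<And>i. \<not> kleene_eq app (S i) (T i)"
  shows "\<not> sim app \<gamma> (S i) (T i)"
proof (induction \<gamma> arbitrary: i rule: less_induct)
  case (less \<gamma>)
  have "\<not> sim app \<beta> (S i \<cdot> Elem (x i)) (T i \<cdot> Elem (x i))" if "\<beta> < \<gamma>" for \<beta>
    using less.IH[OF that, of "Suc i"] sim_cong[OF branch] by simp
  then show ?case
    using ne[of i] sim_iff by blast
qed

end


section \<open>Branches of closed relations\<close>

definition agree :: "nat \<Rightarrow> (nat \<Rightarrow> 'c) \<Rightarrow> (nat \<Rightarrow> 'c) \<Rightarrow> bool" where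
  "agree k z w \<longleftrightarrow> (\<forall>j<k. z j = w j)"

text \<open>
  The Kunen--Martin argument: \<^verbatim>\<open>Q \<beta> z\<close> is to be read as ``the rank of \<^verbatim>\<open>z\<close> exceeds \<^verbatim>\<open>\<beta>\<close>''.
\<close>

lemma closed_relation_branch:
  fixes C :: "(nat \<Rightarrow> 'c :: countable) \<Rightarrow> (nat \<Rightarrow> 'c) \<Rightarrow> bool"
    and Q :: "'a ordinal \<Rightarrow> (nat \<Rightarrow> 'c) \<Rightarrow> bool"
  assumes unc: "uncountable (UNIV :: 'a set)"
    and closed: "\<And>z z'. (\<And>k. \<exists>w w'. agree k w z \<and> agree k w' z' \<and> C w w') \<Longrightarrow> C z z'"
    and antimono: "\<And>\<beta> \<beta>' z. \<beta> \<le> \<beta>' \<Longrightarrow> Q \<beta>' z \<Longrightarrow> Q \<beta> z"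
    and step: "\<And>\<beta> \<beta>' z. \<beta> < \<beta>' \<Longrightarrow> Q \<beta>' z \<Longrightarrow> \<exists>z'. C z z' \<and> Q \<beta> z'"
    and start: "\<And>\<beta>. \<beta> < omega1 \<Longrightarrow> Q \<beta> z0"
  shows "\<exists>z. z 0 = z0 \<and> (\<forall>i. C (z i) (z (Suc i)))"
proof -
  define chain where "chain k \<beta> w \<longleftrightarrow> w 0 = z0 \<and> (\<forall>i<k. C (w i) (w (Suc i))) \<and> Q \<beta> (w k)"
    for k \<beta> w
  define near where "near k w z \<longleftrightarrow> (\<forall>i\<le>k. agree k (w i) (z i))" for k and w z :: "nat \<Rightarrow> nat \<Rightarrow> 'c"
  \<comment> \<open>The invariant: the finite corner of \<open>z\<close> seen by
    \<open>near k\<close> is shared by chains of \<open>k\<close> steps whose end points have ranks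
    unbounded below \<open>omega1\<close>.\<close>
  define big where "big k z \<longleftrightarrow> (\<forall>\<beta><omega1. \<exists>w. chain k \<beta> w \<and> near k w z)" for k z
  have extend: "\<exists>z'. big (Suc k) z' \<and> near k z' z" if "big k z" for k z
  proof -
    have "\<exists>w. chain (Suc k) \<beta> w \<and> near k w z" if "\<beta> < omega1" for \<beta>
    proof -
      \<comment> \<open>Each step costs rank, so a chain for a larger \<beta>' is extended to one
        for \<beta>.\<close>
      obtain \<beta>' where \<beta>': "\<beta>' < omega1" "\<beta> < \<beta>'"
        using omega1_regular[OF unc, of "{\<beta>}"] \<open>\<beta> < omega1\<close> by auto
      then obtain w where w: "chain k \<beta>' w" "near k w z"
        using \<open>big k z\<close> unfolding big_def by blast
      then obtain z' where z': "C (w k) z'" "Q \<beta> z'"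
        using step[OF \<beta>'(2)] unfolding chain_def by blast
      have "chain (Suc k) \<beta> (w(Suc k := z'))" "near k (w(Suc k := z')) z"
        using w z' by (auto simp: chain_def near_def less_Suc_eq)
      then show ?thesis by blast
    qed
    then obtain w where w: "\<And>\<beta>. \<beta> < omega1 \<Longrightarrow> chain (Suc k) \<beta> (w \<beta>) \<and> near k (w \<beta>) z"
      by metis
    \<comment> \<open>The colour is the corner that \<open>near (Suc k)\<close> inspects, a list of
      lists over a countable type.\<close>
    define c where "c \<beta> = map (\<lambda>i. map (w \<beta> i) [0..<Suc k]) [0..<Suc (Suc k)]" for \<beta>
    have c: "near (Suc k) (w \<beta>) (w \<beta>')" if "c \<beta> = c \<beta>'" for \<beta> \<beta>'
      using that unfolding c_def near_def agree_def by (auto simp del: upt_Suc)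
    obtain u where u: "\<And>\<beta>. \<beta> < omega1 \<Longrightarrow> \<exists>\<beta>'<omega1. \<beta> \<le> \<beta>' \<and> c \<beta>' = u"
      using omega1_pigeonhole[OF unc, of c] by blast
    obtain \<beta>0 :: "'a ordinal" where "\<beta>0 < omega1"
      using omega1_regular[OF unc, of "{}"] by auto
    then obtain \<beta>1 where \<beta>1: "\<beta>1 < omega1" "c \<beta>1 = u"
      using u by blast
    \<comment> \<open>Chains of colour \<open>u\<close> occur above every \<beta>, and any one of
      them represents all.\<close>
    have "big (Suc k) (w \<beta>1)"
      unfolding big_def
    proof (intro allI impI)
      fix \<beta> :: "'a ordinal" assume "\<beta> < omega1"
      then obtain \<beta>' where \<beta>': "\<beta>' < omega1" "\<beta> \<le> \<beta>'" "c \<beta>' = u"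
        using u by blast
      have "chain (Suc k) \<beta> (w \<beta>')"
        using w[OF \<beta>'(1)] antimono[OF \<beta>'(2)] unfolding chain_def by blast
      moreover have "near (Suc k) (w \<beta>') (w \<beta>1)"
        using c \<beta>' \<beta>1 by simp
      ultimately show "\<exists>v. chain (Suc k) \<beta> v \<and> near (Suc k) v (w \<beta>1)" by blast
    qed
    moreover have "near k (w \<beta>1) z"
      using w[OF \<beta>1(1)] by blast
    ultimately show ?thesis by blast
  qed
  have big_0: "big 0 (\<lambda>_. z0)"
    unfolding big_def chain_def near_def agree_def using start by auto
  have "\<exists>Z. \<forall>k. big k (Z k) \<and> near k (Z (Suc k)) (Z k)"
  proof (rule dependent_nat_choice)
    show "\<exists>z. big 0 z" using big_0 by (rule exI[where P = "big 0"])
    show "\<exists>z'. big (Suc k) z' \<and> near k z' z" if "big k z" for z k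
      using that by (rule extend)
  qed
  then obtain Z where Z: "\<And>k. big k (Z k)" "\<And>k. near k (Z (Suc k)) (Z k)"
    by blast
  have Z_add: "near k (Z (k + d)) (Z k)" for k d
  proof (induction d)
    case (Suc d)
    then show ?case
      using Z(2)[of "k + d"] by (force simp: near_def agree_def)
  qed (simp add: near_def agree_def)
  have Z_le: "near k (Z l) (Z k)" if "k \<le> l" for k l
    using Z_add[of k "l - k"] that by simp
  \<comment> \<open>Diagonal limit: from stage \<open>Suc (i + j)\<close> on, entry
    \<open>(i, j)\<close> no longer changes.\<close>
  define z where "z i j = Z (Suc (i + j)) i j" for i j
  have z: "agree k (Z k i) (z i)" if "i \<le> k" for i k
    unfolding agree_def
  proof (intro allI impI)
    fix j assume "j < k"
    then show "Z k i j = z i j"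
      using Z_le[of k "Suc (i + j)"] Z_le[of "Suc (i + j)" k] that
      unfolding near_def agree_def z_def by (cases "k \<le> Suc (i + j)") auto
  qed
  have approx: "\<exists>w. w 0 = z0 \<and> (\<forall>i<k. C (w i) (w (Suc i))) \<and> (\<forall>i\<le>k. agree k (w i) (z i))" for k
  proof -
    obtain \<beta>0 :: "'a ordinal" where "\<beta>0 < omega1"
      using omega1_regular[OF unc, of "{}"] by auto
    then obtain w where "chain k \<beta>0 w" "near k w (Z k)"
      using Z(1) unfolding big_def by blast
    then show ?thesis
      using z by (intro exI[of _ w]) (auto simp: chain_def near_def agree_def)
  qed
  have "z 0 = z0"
  proof
    fix j
    obtain w where "w (0 :: nat) = z0" "\<forall>i\<le>Suc j. agree (Suc j) (w i) (z i)"
      using approx[of "Suc j"] by blast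
    then show "z 0 j = z0 j" by (force simp: agree_def)
  qed
  moreover have "C (z i) (z (Suc i))" for i
  proof (rule closed)
    fix k
    obtain w where w: "\<forall>j<Suc (i + k). C (w j) (w (Suc j))"
        "\<forall>j\<le>Suc (i + k). agree (Suc (i + k)) (w j) (z j)"
      using approx[of "Suc (i + k)"] by blast
    have "C (w i) (w (Suc i))" "agree (Suc (i + k)) (w i) (z i)"
        "agree (Suc (i + k)) (w (Suc i)) (z (Suc i))"
      using w by simp_all
    then show "\<exists>w w'. agree k w (z i) \<and> agree k w' (z (Suc i)) \<and> C w w'"
      by (intro exI[of _ "w i"] exI[of _ "w (Suc i)"]) (simp add: agree_def)
  qed
  ultimately show ?thesis by blast
qed


section \<open>Application in Kleene's second model as a closed relation\<close>

text \<open>Partial values become points of a sequence space over a countable alphabet, with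
  definedness readable at any single coordinate.\<close>

definition enc :: "(nat \<Rightarrow> nat) option \<Rightarrow> nat \<Rightarrow> nat option" where
  "enc p j = map_option (\<lambda>f. f j) p"

lemma enc_simps [simp]: "enc None j = None" "enc (Some f) j = Some (f j)"
  by (simp_all add: enc_def)

lemma enc_eq_iff: "enc p = enc q \<longleftrightarrow> p = q"
  by (cases p; cases q) (auto simp: fun_eq_iff)

text \<open>
  The \<^verbatim>\<open>n\<close>-th instance of the closed condition that \<^verbatim>\<open>P'\<close> is the value of \<^verbatim>\<open>P\<close> at \<^verbatim>\<open>x\<close>. The witness
  \<^verbatim>\<open>w\<close> gives the numbers of queried values if the application is defined, and otherwise in \<^verbatim>\<open>w 0\<close>
  an argument without value.
\<close>

definition app_cond ::
  "nat \<Rightarrow> (nat \<Rightarrow> nat option) \<Rightarrow> (nat \<Rightarrow> nat) \<Rightarrow> (nat \<Rightarrow> nat) \<Rightarrow> (nat \<Rightarrow> nat option) \<Rightarrow> bool" where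
  "app_cond n P x w P' \<longleftrightarrow>
     (if P 0 = None then P' n = None
      else if P' 0 = None then P' n = None \<and> P (K2_query x (w 0) n) = Some 0
      else P' n \<noteq> None \<and> P (K2_query x n (w n)) = map_option Suc (P' n) \<and>
        (\<forall>k<w n. P (K2_query x n k) = Some 0))"

lemma K2_query_cong: "agree k x y \<Longrightarrow> K2_query x n k = K2_query y n k"
  by (auto simp: K2_query_def agree_def intro: arg_cong[where f = list_encode])

lemma app_cond_closed:
  assumes "\<And>K. \<exists>P1 x1 w1 P1'. agree K P1 P \<and> agree K x1 x \<and> agree K w1 w \<and> agree K P1' P' \<and>
    app_cond n P1 x1 w1 P1'"
  shows "app_cond n P x w P'"
proof -
  \<comment> \<open>Bounds every position and prefix length that the condition reads, so agreement
    below \<open>K\<close> transfers it.\<close>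
  define A where "A = insert n (insert (w n) (insert (K2_query x (w 0) n) (K2_query x n ` {..w n})))"
  define K where "K = Suc (Max A)"
  have "finite A" unfolding A_def by simp
  then have "a < K" if "a \<in> A" for a
    using that unfolding K_def by (simp add: less_Suc_eq_le)
  then have lt: "n < K" "w n < K" "K2_query x (w 0) n < K" "\<And>k. k \<le> w n \<Longrightarrow> K2_query x n k < K"
    by (auto simp: A_def)
  obtain P1 x1 w1 P1' where ag: "agree K P1 P" "agree K x1 x" "agree K w1 w" "agree K P1' P'"
    and cond: "app_cond n P1 x1 w1 P1'"
    using assms by blast
  have q: "K2_query x1 m k = K2_query x m k" if "k < K" for m k
    using ag(2) that by (intro K2_query_cong) (auto simp: agree_def)
  have "P1 a = P a" "w1 a = w a" "P1' a = P' a" if "a < K" for a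
    using ag that by (auto simp: agree_def)
  then show ?thesis
    using cond lt unfolding app_cond_def by (auto simp: q split: if_splits)
qed

text \<open>When \<open>P\<close> is defined, \<open>P' 0\<close> fixes the role of \<open>n\<close>
  in all instances: a prefix length tested at the bad argument \<open>w 0\<close>, or an argument
  whose least answering prefix length is \<open>w n\<close>.\<close>

lemma app_cond_sound:
  assumes "\<And>n. app_cond n (enc p) x w P'"
  shows "P' = enc (Option.bind p (\<lambda>f. K2_app f x))"
proof (cases p)
  case None
  then show ?thesis using assms by (auto simp: app_cond_def)
next
  case (Some f)
  show ?thesis
  proof (cases "P' 0 = None")
    case True
    then have "P' n = None" "f (K2_query x (w 0) n) = 0" for n
      using assms[of n] by (simp_all add: app_cond_def Some)
    then have "P' = enc None" "\<not> (\<exists>k. f (K2_query x (w 0) k) > 0)"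
      by auto
    moreover from this(2) have "K2_app f x = None"
      unfolding K2_app_def by (intro if_not_P) blast
    ultimately show ?thesis by (simp add: Some)
  next
    case False
    have n: "P' n \<noteq> None" "Some (f (K2_query x n (w n))) = map_option Suc (P' n)"
        "\<And>k. k < w n \<Longrightarrow> f (K2_query x n k) = 0" for n
      using assms[of n] False by (simp_all add: app_cond_def Some)
    have pos: "f (K2_query x n (w n)) > 0" for n
      using n(1,2)[of n] by auto
    have "(LEAST k. f (K2_query x n k) > 0) = w n" for n
      using pos n(3) by (intro Least_equality) (auto simp: not_less[symmetric])
    then have "K2_app f x = Some (\<lambda>n. f (K2_query x n (w n)) - 1)"
      unfolding K2_app_def using pos by auto
    moreover have "P' n = Some (f (K2_query x n (w n)) - 1)" for n
      using n(1,2)[of n] by auto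
    ultimately show ?thesis by (auto simp: Some)
  qed
qed

lemma app_cond_complete: "\<exists>w. \<forall>n. app_cond n (enc p) x w (enc (Option.bind p (\<lambda>f. K2_app f x)))"
proof (cases p)
  case None
  then show ?thesis by (auto simp: app_cond_def)
next
  case (Some f)
  show ?thesis
  proof (cases "\<forall>n. \<exists>k. f (K2_query x n k) > 0")
    case True
    define w where "w n = (LEAST k. f (K2_query x n k) > 0)" for n
    have "K2_app f x = Some (\<lambda>n. f (K2_query x n (w n)) - 1)"
      using True unfolding K2_app_def w_def by simp
    moreover have "f (K2_query x n (w n)) > 0" for n
      unfolding w_def using True by (metis (no_types, lifting) LeastI_ex)
    moreover have "f (K2_query x n k) = 0" if "k < w n" for n k
      using not_less_Least[OF that[unfolded w_def]] by simp
    ultimately show ?thesis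
      by (intro exI[of _ w]) (simp add: app_cond_def Some)
  next
    case False
    then obtain m where "\<And>k. f (K2_query x m k) = 0" by auto
    moreover have "K2_app f x = None"
      using False unfolding K2_app_def by (rule if_not_P)
    ultimately show ?thesis
      by (intro exI[of _ "\<lambda>_. m"]) (simp add: app_cond_def Some)
  qed
qed


section \<open>The upper bound\<close>

text \<open>
  A point of the branch carries, coordinatewise, the values of the two terms, the argument leading
  there, the witnesses for both applications, and (in coordinate 0) a place where the values differ.
\<close>

type_synonym node = "nat \<Rightarrow> nat option \<times> nat option \<times> nat \<times> nat \<times> nat \<times> nat"

definition lval :: "node \<Rightarrow> nat \<Rightarrow> nat option" where "lval z j = fst (z j)"
definition rval :: "node \<Rightarrow> nat \<Rightarrow> nat option" where "rval z j = fst (snd (z j))"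
definition arg :: "node \<Rightarrow> nat \<Rightarrow> nat" where "arg z j = fst (snd (snd (z j)))"
definition lwit :: "node \<Rightarrow> nat \<Rightarrow> nat" where "lwit z j = fst (snd (snd (snd (z j))))"
definition rwit :: "node \<Rightarrow> nat \<Rightarrow> nat" where "rwit z j = fst (snd (snd (snd (snd (z j)))))"
definition diff :: "node \<Rightarrow> nat \<Rightarrow> nat" where "diff z j = snd (snd (snd (snd (snd (z j)))))"

lemmas node_defs = lval_def rval_def arg_def lwit_def rwit_def diff_def

lemma ex_node:
  "\<exists>z. lval z = P \<and> rval z = R \<and> arg z = x \<and> lwit z = u \<and> rwit z = v \<and> diff z = d"
  by (rule exI[of _ "\<lambda>j. (P j, R j, x j, u j, v j, d j)"]) (simp add: node_defs fun_eq_iff)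

definition differing :: "node \<Rightarrow> bool" where
  "differing z \<longleftrightarrow> lval z (diff z 0) \<noteq> rval z (diff z 0)"

text \<open>Requiring a difference only at the source suffices, since every point of an infinite
  branch is the source of a step.\<close>

definition node_step :: "node \<Rightarrow> node \<Rightarrow> bool" where
  "node_step z z' \<longleftrightarrow> differing z \<and>
     (\<forall>n. app_cond n (lval z) (arg z') (lwit z') (lval z')) \<and>
     (\<forall>n. app_cond n (rval z) (arg z') (rwit z') (rval z'))"

lemma node_step_closed:
  assumes "\<And>k. \<exists>w w'. agree k w z \<and> agree k w' z' \<and> node_step w w'"
  shows "node_step z z'"
proof -
  have "agree k (lval w) (lval z)" "agree k (rval w) (rval z)" "agree k (arg w) (arg z)"
      "agree k (lwit w) (lwit z)" "agree k (rwit w) (rwit z)" "agree k (diff w) (diff z)"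
    if "agree k w z" for k w z
    using that by (simp_all add: agree_def node_defs)
  note ag = this
  have "differing z"
  proof -
    obtain w where "agree (Suc (diff z 0)) w z" "differing w"
      using assms[of "Suc (diff z 0)"] unfolding node_step_def by blast
    then show ?thesis
      unfolding differing_def agree_def node_defs by auto
  qed
  moreover have "app_cond n (lval z) (arg z') (lwit z') (lval z')" for n
    by (rule app_cond_closed) (use assms ag in \<open>unfold node_step_def, meson\<close>)
  moreover have "app_cond n (rval z) (arg z') (rwit z') (rval z')" for n
    by (rule app_cond_closed) (use assms ag in \<open>unfold node_step_def, meson\<close>)
  ultimately show ?thesis by (simp add: node_step_def)
qed

lemma uncountable_baire: "uncountable (UNIV :: (nat \<Rightarrow> nat) set)"
proof
  assume "countable (UNIV :: (nat \<Rightarrow> nat) set)"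
  then obtain e :: "nat \<Rightarrow> nat \<Rightarrow> nat" where "surj e"
    using uncountable_def[of "UNIV :: (nat \<Rightarrow> nat) set"] by auto
  then obtain n where "e n = (\<lambda>m. Suc (e m m))"
    by (metis surjD)
  then have "e n n = Suc (e n n)" by (rule fun_cong)
  then show False by simp
qed

lemma infinite_baire: "infinite (UNIV :: (nat \<Rightarrow> nat) set)"
  using uncountable_baire uncountable_infinite by blast

lemma sim_imp_sim_omega1:
  assumes "sim K2_app \<gamma> s t"
  shows "sim K2_app omega1 s t"
proof (rule ccontr)
  assume not_sim: "\<not> sim K2_app omega1 s t"
  let ?ev = "eval_cterm K2_app"
  \<comment> \<open>Nodes store values, not terms, so any terms with these values may witness the
    rank.\<close>
  define Q where "Q \<beta> z \<longleftrightarrow> (\<exists>s t. \<not> sim K2_app \<beta> s t \<and> lval z = enc (?ev s) \<and>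
      rval z = enc (?ev t) \<and> differing z)" for \<beta> z
  have node: "\<exists>z. lval z = enc (?ev s) \<and> rval z = enc (?ev t) \<and> arg z = x \<and>
      lwit z = u \<and> rwit z = v \<and> differing z" if "\<not> sim K2_app \<beta> s t" for \<beta> s t x u v
  proof -
    have "?ev s \<noteq> ?ev t"
      using that kleene_eq_imp_sim[OF infinite_baire] by (auto simp: kleene_eq_def)
    then obtain d where "enc (?ev s) d \<noteq> enc (?ev t) d"
      by (metis enc_eq_iff ext)
    then show ?thesis
      using ex_node[of "enc (?ev s)" "enc (?ev t)" x u v "\<lambda>_. d"] unfolding differing_def by metis
  qed
  obtain z0 where z0: "lval z0 = enc (?ev s)" "rval z0 = enc (?ev t)" "differing z0"
    using node[OF not_sim] by blast
  have "\<exists>z. z 0 = z0 \<and> (\<forall>i. node_step (z i) (z (Suc i)))"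
  proof (rule closed_relation_branch[OF uncountable_baire node_step_closed])
    show "Q \<beta> z" if "\<beta> \<le> \<beta>'" "Q \<beta>' z" for \<beta> \<beta>' z
      using that sim_mono[OF infinite_baire] unfolding Q_def by blast
    show "Q \<beta> z0" if "\<beta> < omega1" for \<beta>
      using not_sim sim_mono[OF infinite_baire, of \<beta> omega1] z0 that unfolding Q_def
      by (meson less_imp_le)
    show "\<exists>z'. node_step z z' \<and> Q \<beta> z'" if lt: "\<beta> < \<beta>'" and "Q \<beta>' z" for \<beta> \<beta>' z
    proof -
      obtain s t where st: "\<not> sim K2_app \<beta>' s t" "lval z = enc (?ev s)" "rval z = enc (?ev t)"
          "differing z"
        using \<open>Q \<beta>' z\<close> unfolding Q_def by blast
      then obtain x where x: "\<not> sim K2_app \<beta> (s \<cdot> Elem x) (t \<cdot> Elem x)"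
        using sim_iff[OF infinite_baire, of K2_app \<beta>'] lt by blast
      obtain u where u: "\<And>n. app_cond n (enc (?ev s)) x u (enc (?ev (s \<cdot> Elem x)))"
        using app_cond_complete unfolding eval_cterm_App_Elem by metis
      obtain v where v: "\<And>n. app_cond n (enc (?ev t)) x v (enc (?ev (t \<cdot> Elem x)))"
        using app_cond_complete unfolding eval_cterm_App_Elem by metis
      obtain z' where "lval z' = enc (?ev (s \<cdot> Elem x))" "rval z' = enc (?ev (t \<cdot> Elem x))"
          "arg z' = x" "lwit z' = u" "rwit z' = v" "differing z'"
        using node[OF x] by blast
      then show ?thesis
        using x st u v unfolding node_step_def Q_def by metis
    qed
  qed
  then obtain z where z: "z 0 = z0" "\<And>i. node_step (z i) (z (Suc i))" by blast
  \<comment> \<open>The terms are rebuilt from the arguments stored along the branch;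
    \<open>app_cond_sound\<close> then identifies their values.\<close>
  define S where "S = rec_nat s (\<lambda>i r. r \<cdot> Elem (arg (z (Suc i))))"
  define T where "T = rec_nat t (\<lambda>i r. r \<cdot> Elem (arg (z (Suc i))))"
  have S_Suc: "S (Suc i) = S i \<cdot> Elem (arg (z (Suc i)))"
    and T_Suc: "T (Suc i) = T i \<cdot> Elem (arg (z (Suc i)))" for i
    by (simp_all add: S_def T_def)
  have vals: "lval (z i) = enc (?ev (S i)) \<and> rval (z i) = enc (?ev (T i))" for i
  proof (induction i)
    case 0
    then show ?case by (simp add: z z0 S_def T_def)
  next
    case (Suc i)
    have "lval (z (Suc i)) = enc (?ev (S (Suc i)))"
      using app_cond_sound[of "?ev (S i)" "arg (z (Suc i))"] z(2)[of i] Suc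
      unfolding node_step_def S_Suc eval_cterm_App_Elem by metis
    moreover have "rval (z (Suc i)) = enc (?ev (T (Suc i)))"
      using app_cond_sound[of "?ev (T i)" "arg (z (Suc i))"] z(2)[of i] Suc
      unfolding node_step_def T_Suc eval_cterm_App_Elem by metis
    ultimately show ?case ..
  qed
  have "\<not> kleene_eq K2_app (S i) (T i)" for i
    using z(2)[of i] vals[of i] unfolding node_step_def differing_def kleene_eq_def by metis
  then have "\<not> sim K2_app \<gamma> (S 0) (T 0)"
    by (intro not_sim_infinite_branch[OF infinite_baire, where x = "\<lambda>i. arg (z (Suc i))"])
       (simp_all add: S_def T_def)
  then show False using assms by (simp add: S_def T_def)
qed


section \<open>The lower bound\<close>

text \<open>
  The value at the code \<^verbatim>\<open>0\<close> of the empty sequence is never used in an application, so \<^verbatim>\<open>e\<close> only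
  serves to make joins different.
\<close>

definition join :: "nat \<Rightarrow> (nat \<Rightarrow> nat \<Rightarrow> nat) \<Rightarrow> nat \<Rightarrow> nat" where
  "join e a c = (case list_decode c of [] \<Rightarrow> e | [m] \<Rightarrow> 0 | m # n # _ \<Rightarrow> Suc (a n m))"

text \<open>The empty prefix of \<open>x\<close> gets the answer 0, asking for more, and the prefix
  of length one always gets a positive answer, so only \<open>x 0\<close> is read.\<close>

lemma K2_app_join: "K2_app (join e a) x = Some (a (x 0))"
proof -
  have 0: "join e a (K2_query x n 0) = 0" for n
    by (simp add: join_def K2_query_def)
  have 1: "join e a (K2_query x n (Suc 0)) = Suc (a (x 0) n)" for n
    by (simp add: join_def K2_query_def)
  have "(LEAST k. join e a (K2_query x n k) > 0) = Suc 0" for n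
    by (rule Least_equality) (use 0 1 in \<open>auto simp: Suc_le_eq intro: gr0I\<close>)
  moreover have "\<exists>k. join e a (K2_query x n k) > 0" for n
    using 1[of n] by (metis zero_less_Suc)
  ultimately show ?thesis
    unfolding K2_app_def by (simp add: 1)
qed

lemma join_neq: "join 0 a \<noteq> join 1 b"
proof
  assume "join 0 a = join 1 b"
  then have "join 0 a 0 = join 1 b 0" by simp
  then show False by (simp add: join_def)
qed

lemma ex_late_sim:
  fixes \<alpha> :: "(nat \<Rightarrow> nat) ordinal"
  assumes "\<alpha> < omega1"
  shows "\<exists>f g. \<not> sim K2_app \<alpha> (Elem f) (Elem g) \<and> (\<exists>\<gamma><omega1. sim K2_app \<gamma> (Elem f) (Elem g))"
  using assms
proof (induction \<alpha> rule: less_induct)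
  case (less \<alpha>)
  \<comment> \<open>For \<alpha> = 0 the set is empty and \<open>b n\<close> is arbitrary, hence the
    guard \<open>b n < \<alpha>\<close> below; where it fails, a pair of equal elements is
    taken.\<close>
  define b where "b = from_nat_into {..<\<alpha>}"
  have "\<exists>f g. (b n < \<alpha> \<longrightarrow> \<not> sim K2_app (b n) (Elem f) (Elem g)) \<and>
      (\<exists>\<gamma><omega1. sim K2_app \<gamma> (Elem f) (Elem g))" for n
  proof (cases "b n < \<alpha>")
    case True
    then show ?thesis using less.IH[of "b n"] less.prems by force
  next
    case False
    have "sim K2_app \<alpha> (Elem f) (Elem f)" for f
      by (rule kleene_eq_imp_sim[OF infinite_baire]) (simp add: kleene_eq_def)
    then show ?thesis using False less.prems by blast
  qed
  then obtain f g \<gamma> where fg: "\<And>n. b n < \<alpha> \<Longrightarrow> \<not> sim K2_app (b n) (Elem (f n)) (Elem (g n))"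
      and \<gamma>: "\<And>n. \<gamma> n < omega1" "\<And>n. sim K2_app (\<gamma> n) (Elem (f n)) (Elem (g n))"
    by metis
  let ?F = "Elem (join 0 f)" and ?G = "Elem (join 1 g)"
  have app: "sim K2_app \<beta> (?F \<cdot> Elem x) (?G \<cdot> Elem x) \<longleftrightarrow>
      sim K2_app \<beta> (Elem (f (x 0))) (Elem (g (x 0)))" for \<beta> x
    by (rule sim_cong[OF infinite_baire]) (simp_all add: K2_app_join)
  have "\<not> sim K2_app \<alpha> ?F ?G"
  proof
    assume "sim K2_app \<alpha> ?F ?G"
    then obtain \<beta> where \<beta>: "\<beta> < \<alpha>" "\<And>x. sim K2_app \<beta> (?F \<cdot> Elem x) (?G \<cdot> Elem x)"
      unfolding sim_iff[OF infinite_baire, of _ \<alpha>] kleene_eq_def using join_neq by auto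
    \<comment> \<open>An argument starting with this \<open>n\<close> selects the pair that is not
      related at \<beta>.\<close>
    obtain n where "b n = \<beta>"
      unfolding b_def using from_nat_into_surj[of "{..<\<alpha>}" \<beta>] \<beta>(1) less.prems
      by (auto simp: countable_lessThan_ordinal)
    then show False
      using fg[of n] \<beta>(1) \<beta>(2)[of "\<lambda>_. n"] by (simp only: app)
  qed
  \<comment> \<open>At \<delta> all applications of the joins are related, so the joins themselves
    are related at any larger \<epsilon>.\<close>
  moreover obtain \<delta> where \<delta>: "\<delta> < omega1" "\<And>n. \<gamma> n < \<delta>"
    using omega1_regular[OF uncountable_baire, of "range \<gamma>"] \<gamma>(1) by auto
  moreover obtain \<epsilon> where "\<epsilon> < omega1" "\<delta> < \<epsilon>"
    using omega1_regular[OF uncountable_baire, of "{\<delta>}"] \<delta>(1) by auto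
  moreover have "sim K2_app \<delta> (?F \<cdot> Elem x) (?G \<cdot> Elem x)" for x
    unfolding app using sim_mono[OF infinite_baire less_imp_le[OF \<delta>(2)] \<gamma>(2)] .
  ultimately show ?case
    using sim_iff[OF infinite_baire] by blast
qed

theorem theorem9p1:
  shows "ord_pca K2_app = omega1"
  unfolding ord_pca_def
proof (rule Least_equality)
  have "sim K2_app (succ_ord omega1) s t" if "sim K2_app omega1 s t" for s t
    using sim_mono[OF infinite_baire less_imp_le[OF less_succ_ord[OF infinite_baire]] that] .
  then show "sim K2_app omega1 = sim K2_app (succ_ord omega1)"
    using sim_imp_sim_omega1 by blast
next
  fix \<alpha> assume "sim K2_app \<alpha> = sim K2_app (succ_ord \<alpha>)"
  then have "sim K2_app \<gamma> s t \<Longrightarrow> sim K2_app \<alpha> s t" for \<gamma> s t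
    by (rule sim_stationary[OF infinite_baire])
  \<comment> \<open>For \<alpha> below \<open>omega1\<close>, a pair related later but not at
    \<alpha> would contradict stationarity.\<close>
  then show "omega1 \<le> \<alpha>"
    using ex_late_sim[of \<alpha>] by (meson not_le)
qed

end
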